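(* Let $\mathscr{A}$ be a complex Banach algebra with unit $1$. Let $a,\delta a\in\mathscr{A}$ and let $p,q\in\mathscr{A}$ be idempotents such that $a^{(2)}_{p,q}$ exists. Put $\bar a=a+\delta a$, and suppose that $1+a^{(2)}_{p,q}\,\delta a$ is invertible. Then the following statements are equivalent: (1) $\bar a^{(2)}_{p,q}$ exists and $\bar a^{(2)}_{p,q}=a^{(2)}_{p,q}(1+\delta a\,a^{(2)}_{p,q})^{-1}$; (2) $\bar a p=(1-q)\bar a$; (3) $\bar a\,a^{(2)}_{p,q}=(1-q)\bar a\,a^{(2)}_{p,q}$ and $a^{(2)}_{p,q}\bar a=a^{(2)}_{p,q}\bar a p$.
   Context: For $a\in\mathscr{A}$ and idempotents $p,q\in\mathscr{A}$, the $(p,q)$-outer generalized inverse $a^{(2)}_{p,q}$ is an element $b\in\mathscr{A}$ with $bab=b$, $ba=p$ and $1-ab=q$; it is unique if it exists. *)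

theory Defs
  imports Complex_Main
begin

text \<open>
  A complex Banach algebra with unit. The real scalar multiplication inherited from
  \<^class>\<open>real_normed_algebra\<close> is the restriction of the complex one. The unit comes from
  \<^class>\<open>monoid_mult\<close> instead of \<^class>\<open>real_normed_algebra_1\<close>, so neither
  \<open>norm 1 = 1\<close> nor \<open>0 \<noteq> 1\<close> is required.
\<close>

class complex_banach_algebra_unit = real_normed_algebra + banach + monoid_mult +
  fixes scaleC :: "complex \<Rightarrow> 'a \<Rightarrow> 'a"  (infixr "*\<^sub>C" 75)
  assumes scaleC_add_right: "c *\<^sub>C (x + y) = c *\<^sub>C x + c *\<^sub>C y"
    and scaleC_add_left: "(c + d) *\<^sub>C x = c *\<^sub>C x + d *\<^sub>C x"
    and scaleC_scaleC: "c *\<^sub>C (d *\<^sub>C x) = (c * d) *\<^sub>C x"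
    and scaleC_one: "1 *\<^sub>C x = x"
    and scaleR_scaleC: "r *\<^sub>R x = complex_of_real r *\<^sub>C x"
    and mult_scaleC_left: "(c *\<^sub>C x) * y = c *\<^sub>C (x * y)"
    and mult_scaleC_right: "x * (c *\<^sub>C y) = c *\<^sub>C (x * y)"
    and norm_scaleC: "norm (c *\<^sub>C x) = cmod c * norm x"

instantiation complex :: complex_banach_algebra_unit
begin

definition scaleC_complex :: "complex \<Rightarrow> complex \<Rightarrow> complex"
  where "scaleC_complex c x = c * x"

instance
  by standard (simp_all add: scaleC_complex_def algebra_simps norm_mult scaleR_conv_of_real)

end

definition is_inverse :: "'a::monoid_mult \<Rightarrow> 'a \<Rightarrow> bool"
  where "is_inverse x y \<longleftrightarrow> x * y = 1 \<and> y * x = 1"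

definition invertible_element :: "'a::monoid_mult \<Rightarrow> bool"
  where "invertible_element x \<longleftrightarrow> (\<exists>y. is_inverse x y)"

text \<open>Unspecified when the element is not invertible.\<close>

definition inverse_element :: "'a::monoid_mult \<Rightarrow> 'a"
  where "inverse_element x = (THE y. is_inverse x y)"

definition idempotent_element :: "'a::monoid_mult \<Rightarrow> bool"
  where "idempotent_element p \<longleftrightarrow> p * p = p"

definition is_outer_inverse_pq ::
    "'a::complex_banach_algebra_unit \<Rightarrow> 'a \<Rightarrow> 'a \<Rightarrow> 'a \<Rightarrow> bool"
  where "is_outer_inverse_pq a p q b \<longleftrightarrow> b * a * b = b \<and> b * a = p \<and> 1 - a * b = q"

definition outer_inverse_pq_exists ::
    "'a::complex_banach_algebra_unit \<Rightarrow> 'a \<Rightarrow> 'a \<Rightarrow> bool"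
  where "outer_inverse_pq_exists a p q \<longleftrightarrow> (\<exists>b. is_outer_inverse_pq a p q b)"

lemma is_outer_inverse_pq_unique:
  assumes "is_outer_inverse_pq a p q b" and "is_outer_inverse_pq a p q c"
  shows "b = c"
proof -
  have ba: "b * a = c * a" and "1 - a * b = 1 - a * c"
    using assms by (auto simp: is_outer_inverse_pq_def)
  then have ab: "a * b = a * c" by simp
  have "b = b * a * b" using assms(1) unfolding is_outer_inverse_pq_def by metis
  also have "\<dots> = c * (a * b)" by (simp add: ba mult.assoc)
  also have "\<dots> = c * a * c" by (simp add: ab mult.assoc)
  also have "\<dots> = c" using assms(2) unfolding is_outer_inverse_pq_def by metis
  finally show ?thesis .
qed

text \<open>
  The \<open>(p,q)\<close>-outer generalized inverse of \<open>a\<close>; unspecified when it does not exist.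
\<close>

definition outer_inverse_pq ::
    "'a::complex_banach_algebra_unit \<Rightarrow> 'a \<Rightarrow> 'a \<Rightarrow> 'a"
  where "outer_inverse_pq a p q = (THE b. is_outer_inverse_pq a p q b)"

end

theory Submission
  imports Defs
begin

text \<open>
  Write \<open>b\<close> for the outer inverse of \<open>a\<close>, \<open>d\<close> for \<open>\<delta>a\<close> and \<open>A = a + d\<close>, so that \<open>b a = p\<close> and
  \<open>a b = 1 - q\<close>. Everything follows from \<open>b a b = b\<close> and the identities \<open>b A p = (1 + b d) p\<close> and
  \<open>(1 - q) A b = (1 - q) (1 + d b)\<close>: once \<open>b A p = b A\<close> and \<open>(1 - q) A b = A b\<close>, dividing by
  \<open>1 + b d\<close> and \<open>1 + d b\<close> shows that \<open>(1 + b d)\<inverse> b = b (1 + d b)\<inverse>\<close> is the \<open>(p,q)\<close>-outer inverse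
  of \<open>A\<close>.
\<close>

lemma inverse_element_eqI:
  assumes "is_inverse x y"
  shows "inverse_element x = y"
  unfolding inverse_element_def
proof (rule the_equality)
  fix z assume "is_inverse x z"
  then have "z = z * (x * y)" and "z * x = 1"
    using assms by (simp_all add: is_inverse_def)
  then show "z = y"
    by (simp flip: mult.assoc)
qed (fact assms)

lemma outer_inverse_pq_eqI:
  assumes "is_outer_inverse_pq a p q b"
  shows "outer_inverse_pq a p q = b"
  unfolding outer_inverse_pq_def
  using assms is_outer_inverse_pq_unique by blast

lemma is_outer_inverse_pq_outer_inverse_pq:
  assumes "outer_inverse_pq_exists a p q"
  shows "is_outer_inverse_pq a p q (outer_inverse_pq a p q)"
  using assms outer_inverse_pq_eqI unfolding outer_inverse_pq_exists_def by metis

text \<open>The candidate comes from the geometric series: formally, the inverse of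
  \<open>1 + d * b\<close> is \<open>1 - d * (1 - b * d + ...) * b\<close>, and the bracket sums to
  \<open>u\<close>.\<close>

lemma is_inverse_one_plus_commute:
  fixes b d :: "'a::{ring,monoid_mult}"
  assumes "is_inverse (1 + b * d) u"
  shows "is_inverse (1 + d * b) (1 - d * u * b)"
proof -
  have r: "u + b * d * u = 1" and l: "u + u * b * d = 1"
    using assms by (simp_all add: is_inverse_def algebra_simps)
  have "(1 + d * b) * (1 - d * u * b) = 1 + d * b - d * (u + b * d * u) * b"
    by (simp add: algebra_simps)
  moreover have "(1 - d * u * b) * (1 + d * b) = 1 + d * b - d * (u + u * b * d) * b"
    by (simp add: algebra_simps)
  ultimately show ?thesis
    by (simp add: is_inverse_def r l)
qed

text \<open>Rests on \<open>b * (1 + d * b) = (1 + b * d) * b\<close>.\<close>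

lemma inverse_one_plus_intertwine:
  fixes b d :: "'a::{ring,monoid_mult}"
  assumes "is_inverse (1 + b * d) u" and "is_inverse (1 + d * b) v"
  shows "b * v = u * b"
proof -
  have "b * v = u * (1 + b * d) * (b * v)"
    using assms(1) by (simp add: is_inverse_def)
  also have "\<dots> = u * b * ((1 + d * b) * v)"
    by (simp add: algebra_simps)
  also have "\<dots> = u * b"
    using assms(2) by (simp add: is_inverse_def)
  finally show ?thesis .
qed

text \<open>Both sides equal \<open>a * b * a\<close>. Applied to the perturbed element, this gives
  (1) implies (2).\<close>

lemma outer_inverse_pq_intertwine:
  assumes "is_outer_inverse_pq a p q b"
  shows "a * p = (1 - q) * a"
  using assms by (auto simp: is_outer_inverse_pq_def mult.assoc)

text \<open>This is (2) iff (3) for arbitrary \<open>x\<close>: the two one-sided conditions amount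
  to \<open>x * p = (1 - q) * x * p\<close> and
  \<open>(1 - q) * x * p = (1 - q) * x\<close>.\<close>

lemma intertwine_iff_one_sided:
  assumes "is_outer_inverse_pq a p q b"
  shows "x * p = (1 - q) * x \<longleftrightarrow> x * b = (1 - q) * x * b \<and> b * x = b * x * p"
proof -
  have p: "b * a = p" and q: "a * b = 1 - q" and pb: "p * b = b" and bq: "b * (1 - q) = b"
    using assms by (auto simp: is_outer_inverse_pq_def mult.assoc)
  show ?thesis
  proof (intro iffI conjI)
    assume x: "x * p = (1 - q) * x"
    show "x * b = (1 - q) * x * b"
      by (metis x pb mult.assoc)
    show "b * x = b * x * p"
      by (metis x bq mult.assoc)
  next
    assume x: "x * b = (1 - q) * x * b \<and> b * x = b * x * p"
    \<comment> \<open>Multiply the first condition by \<open>a\<close> on the right; below, the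
      second by \<open>a\<close> on the left.\<close>
    have "x * p = (1 - q) * x * p"
      by (metis x p mult.assoc)
    also have "\<dots> = (1 - q) * x"
      by (metis x q mult.assoc)
    finally show "x * p = (1 - q) * x" .
  qed
qed

lemma is_outer_inverse_pq_perturbed:
  assumes b: "is_outer_inverse_pq a p q b"
    and u: "is_inverse (1 + b * d) u" and v: "is_inverse (1 + d * b) v"
    and comm: "(a + d) * p = (1 - q) * (a + d)"
  shows "is_outer_inverse_pq (a + d) p q (b * v)"
proof -
  have p: "b * a = p" and q: "a * b = 1 - q" and pb: "p * b = b" and pp: "p * p = p"
    and qq: "(1 - q) * (1 - q) = 1 - q"
    using b by (auto simp: is_outer_inverse_pq_def mult.assoc) (metis mult.assoc)+
  have r: "(a + d) * b = (1 - q) * (a + d) * b" and l: "b * (a + d) = b * (a + d) * p"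
    using comm intertwine_iff_one_sided[OF b] by blast+
  have "b * (a + d) * p = (1 + b * d) * p"
    by (simp add: distrib_left distrib_right p pp)
  \<comment> \<open>Writing \<open>b * v\<close> as \<open>u * b\<close> puts \<open>u\<close> next
    to \<open>1 + b * d\<close>, where it cancels.\<close>
  then have "b * v * (a + d) = u * ((1 + b * d) * p)"
    by (metis l inverse_one_plus_intertwine[OF u v] mult.assoc)
  then have cA: "b * v * (a + d) = p"
    using u by (metis is_inverse_def mult.assoc mult_1_left)
  have "(1 - q) * (a + d) * b = (1 - q) * (1 + d * b)"
    by (simp add: distrib_left distrib_right mult.assoc q qq)
  then have "(a + d) * (b * v) = (1 - q) * (1 + d * b) * v"
    by (metis r mult.assoc)
  then have Ac: "(a + d) * (b * v) = 1 - q"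
    using v by (metis is_inverse_def mult.assoc mult_1_right)
  show ?thesis
    \<comment> \<open>The outer identity reduces to \<open>p * (b * v) = b * v\<close>.\<close>
    unfolding is_outer_inverse_pq_def cA Ac by (simp add: pb flip: mult.assoc)
qed

theorem theorem3p11:
  fixes a \<delta>a p q :: "'a::complex_banach_algebra_unit"
  assumes "idempotent_element p" and "idempotent_element q"
    and "outer_inverse_pq_exists a p q"
    and "invertible_element (1 + outer_inverse_pq a p q * \<delta>a)"
  shows
    "((outer_inverse_pq_exists (a + \<delta>a) p q \<and>
       outer_inverse_pq (a + \<delta>a) p q =
         outer_inverse_pq a p q * inverse_element (1 + \<delta>a * outer_inverse_pq a p q))
      \<longleftrightarrow> (a + \<delta>a) * p = (1 - q) * (a + \<delta>a)) \<and>
     ((a + \<delta>a) * p = (1 - q) * (a + \<delta>a)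
      \<longleftrightarrow> ((a + \<delta>a) * outer_inverse_pq a p q = (1 - q) * (a + \<delta>a) * outer_inverse_pq a p q \<and>
          outer_inverse_pq a p q * (a + \<delta>a) = outer_inverse_pq a p q * (a + \<delta>a) * p))"
proof -
  let ?b = "outer_inverse_pq a p q"
  have b: "is_outer_inverse_pq a p q ?b"
    using assms(3) by (rule is_outer_inverse_pq_outer_inverse_pq)
  obtain u where u: "is_inverse (1 + ?b * \<delta>a) u"
    using assms(4) unfolding invertible_element_def by blast
  \<comment> \<open>The hypothesis inverts \<open>1 + ?b * \<delta>a\<close>, whereas (1) speaks of
    the inverse of \<open>1 + \<delta>a * ?b\<close>.\<close>
  define v where "v = 1 - \<delta>a * u * ?b"
  have v: "is_inverse (1 + \<delta>a * ?b) v"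
    unfolding v_def using u by (rule is_inverse_one_plus_commute)
  have "(outer_inverse_pq_exists (a + \<delta>a) p q \<and> outer_inverse_pq (a + \<delta>a) p q = ?b * v)
      \<longleftrightarrow> (a + \<delta>a) * p = (1 - q) * (a + \<delta>a)"
    using is_outer_inverse_pq_perturbed[OF b u v] outer_inverse_pq_intertwine
      outer_inverse_pq_eqI outer_inverse_pq_exists_def by metis
  then show ?thesis
    using intertwine_iff_one_sided[OF b] by (simp add: inverse_element_eqI[OF v])
qed

end
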